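(* Let $n\ge 5$ be an integer. If $n$ is even, then $f_d(CF_n,v)=2\lfloor n/2\rfloor$ for every vertex $v\in V(CF_n)$. If $n$ is odd, then $f_d(CF_n,v)=2\lfloor n/2\rfloor$ for every $v\in V(CF_n)\setminus\{u_{(n+3)/2}\}$, and $f_d(CF_n,u_{(n+3)/2})=2\lfloor n/2\rfloor+1$.
   Context: The cuttlefish graph $CF_n$ ($n\ge 3$): start with a cycle on vertices $u_1,\dots,u_n$ with edges $u_iu_{i+1}$ (indices mod $n$). Add new vertices $v_1,\dots,v_{\lfloor n/2\rfloor-1}$ and $w_1,\dots,w_{\lfloor n/2\rfloor-1}$ with edges $u_1v_1$, $v_iv_{i+1}$ and $u_2w_1$, $w_iw_{i+1}$ for $1\le i\le\lfloor n/2\rfloor-2$ (two pendant paths of length $\lfloor n/2\rfloor-1$ attached at $u_1$ and $u_2$). The \emph{Explorer–Director game} on a finite connected graph $G$ with starting vertex $v$: a token starts on $v$; in each round, with the token on $u$, the Explorer names a distance $d$ such that some vertex is at distance $d$ from $u$, and the Director moves the token to any vertex at (shortest-path) distance exactly $d$ from $u$. Visited vertices are those the token has ever occupied (including $v$). The Explorer maximizes and the Director minimizes the number of visited vertices; the game ends when the Director can keep the token on visited vertices indefinitely; $f_d(G,v)$ is the final number of visited vertices under optimal play. *)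

theory Defs
  imports "Graph_Theory.Shortest_Path" "Graph_Theory.Pair_Digraph"
    "Graph_Theory.Digraph_Component"
begin

section \<open>The Explorer--Director game\<close>

text \<open>
  Undirected graphs are symmetric digraphs, as in the locale \<^locale>\<open>graph\<close>.
  Since every arc has weight 1, the value of \<^const>\<open>wf_digraph.\<mu>\<close> is the length of a
  shortest path.
\<close>

definition at_distance :: "('a, 'b) pre_digraph \<Rightarrow> 'a \<Rightarrow> nat \<Rightarrow> 'a set" where
  "at_distance G u d =
     {w \<in> verts G. wf_digraph.\<mu> G (\<lambda>_. 1) u w = ereal (real d)}"

text \<open>
  A history lists the positions of the token so far, the current one last; it determines the
  distances named so far. Strategies may depend on the whole history.
\<close>

definition histories :: "('a, 'b) pre_digraph \<Rightarrow> 'a list set" where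
  "histories G = {h. h \<noteq> [] \<and> set h \<subseteq> verts G}"

definition explorer_strategies :: "('a, 'b) pre_digraph \<Rightarrow> ('a list \<Rightarrow> nat) set" where
  "explorer_strategies G =
     {\<epsilon>. \<forall>h \<in> histories G. at_distance G (last h) (\<epsilon> h) \<noteq> {}}"

definition director_strategies :: "('a, 'b) pre_digraph \<Rightarrow> ('a list \<Rightarrow> nat \<Rightarrow> 'a) set" where
  "director_strategies G =
     {\<delta>. \<forall>h \<in> histories G. \<forall>d.
        at_distance G (last h) d \<noteq> {} \<longrightarrow> \<delta> h d \<in> at_distance G (last h) d}"

primrec history :: "('a list \<Rightarrow> nat) \<Rightarrow> ('a list \<Rightarrow> nat \<Rightarrow> 'a) \<Rightarrow> 'a \<Rightarrow> nat \<Rightarrow> 'a list" where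
  "history \<epsilon> \<delta> v 0 = [v]"
| "history \<epsilon> \<delta> v (Suc t) =
     history \<epsilon> \<delta> v t @ [\<delta> (history \<epsilon> \<delta> v t) (\<epsilon> (history \<epsilon> \<delta> v t))]"

definition token :: "('a list \<Rightarrow> nat) \<Rightarrow> ('a list \<Rightarrow> nat \<Rightarrow> 'a) \<Rightarrow> 'a \<Rightarrow> nat \<Rightarrow> 'a" where
  "token \<epsilon> \<delta> v t = last (history \<epsilon> \<delta> v t)"

text \<open>
  With the token on \<open>u\<close>, the Director can keep it inside \<open>S\<close> indefinitely, whatever distances the
  Explorer names. The definition is coinductive because the Director has to hold out forever.
\<close>

coinductive can_stay :: "('a, 'b) pre_digraph \<Rightarrow> 'a set \<Rightarrow> 'a \<Rightarrow> bool"
  for G :: "('a, 'b) pre_digraph" and S :: "'a set" where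
  "u \<in> S \<Longrightarrow>
   (\<And>d. at_distance G u d \<noteq> {} \<Longrightarrow> \<exists>w \<in> at_distance G u d. can_stay G S w) \<Longrightarrow>
   can_stay G S u"

definition game_over ::
    "('a, 'b) pre_digraph \<Rightarrow> ('a list \<Rightarrow> nat) \<Rightarrow> ('a list \<Rightarrow> nat \<Rightarrow> 'a) \<Rightarrow> 'a \<Rightarrow> nat \<Rightarrow> bool" where
  "game_over G \<epsilon> \<delta> v t \<longleftrightarrow> can_stay G (token \<epsilon> \<delta> v ` {..t}) (token \<epsilon> \<delta> v t)"

text \<open>
  The vertices visited up to and including the first time at which the game is over; if the
  players never reach such a time, all vertices visited during the infinite play.
\<close>

definition visited ::
    "('a, 'b) pre_digraph \<Rightarrow> ('a list \<Rightarrow> nat) \<Rightarrow> ('a list \<Rightarrow> nat \<Rightarrow> 'a) \<Rightarrow> 'a \<Rightarrow> 'a set" where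
  "visited G \<epsilon> \<delta> v = {token \<epsilon> \<delta> v t | t. \<forall>s<t. \<not> game_over G \<epsilon> \<delta> v s}"

text \<open>
  Optimal play: \<open>k\<close> is the value of the game if the Explorer can guarantee at least \<open>k\<close> visited
  vertices and the Director can guarantee at most \<open>k\<close>.
\<close>

definition is_game_value :: "('a, 'b) pre_digraph \<Rightarrow> 'a \<Rightarrow> nat \<Rightarrow> bool" where
  "is_game_value G v k \<longleftrightarrow>
     (\<exists>\<epsilon> \<in> explorer_strategies G. \<forall>\<delta> \<in> director_strategies G. k \<le> card (visited G \<epsilon> \<delta> v)) \<and>
     (\<exists>\<delta> \<in> director_strategies G. \<forall>\<epsilon> \<in> explorer_strategies G. card (visited G \<epsilon> \<delta> v) \<le> k)"

definition f_d :: "('a, 'b) pre_digraph \<Rightarrow> 'a \<Rightarrow> nat" where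
  "f_d G v = (THE k. is_game_value G v k)"

lemma is_game_value_unique:
  assumes "is_game_value G v k" "is_game_value G v l"
  shows "k = l"
  using assms unfolding is_game_value_def by (meson le_antisym order_trans)

lemma f_d_eqI: "is_game_value G v k \<Longrightarrow> f_d G v = k"
  unfolding f_d_def by (blast intro: the_equality is_game_value_unique)


section \<open>Cuttlefish graphs\<close>

datatype cf_vertex = U nat | V nat | W nat

definition cuttlefish_vertices :: "nat \<Rightarrow> cf_vertex set" where
  "cuttlefish_vertices n =
     U ` {1..n} \<union> V ` {1..n div 2 - 1} \<union> W ` {1..n div 2 - 1}"

text \<open>
  Each edge is listed in one direction only. For \<open>n = 3\<close> there are no vertices \<open>V i\<close> and \<open>W i\<close>, so
  the edges at \<open>V 1\<close> and \<open>W 1\<close> are restricted to the case that these vertices exist.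
\<close>

definition cuttlefish_edges :: "nat \<Rightarrow> cf_vertex rel" where
  "cuttlefish_edges n =
     {(U i, U (Suc i)) | i. 1 \<le> i \<and> i < n} \<union> {(U n, U 1)} \<union>
     (if 1 \<le> n div 2 - 1 then {(U 1, V 1)} else {}) \<union>
     {(V i, V (Suc i)) | i. 1 \<le> i \<and> i \<le> n div 2 - 2} \<union>
     (if 1 \<le> n div 2 - 1 then {(U 2, W 1)} else {}) \<union>
     {(W i, W (Suc i)) | i. 1 \<le> i \<and> i \<le> n div 2 - 2}"

definition cuttlefish :: "nat \<Rightarrow> cf_vertex pair_pre_digraph" where
  "cuttlefish n =
     \<lparr>pverts = cuttlefish_vertices n, parcs = symcl (cuttlefish_edges n)\<rparr>"

lemma cuttlefish_pair_graph:
  assumes "n \<ge> 3"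
  shows "pair_graph (cuttlefish n)"
proof -
  have sub: "parcs (cuttlefish n) \<subseteq> pverts (cuttlefish n) \<times> pverts (cuttlefish n)"
    using assms
    by (fastforce simp: cuttlefish_def cuttlefish_vertices_def cuttlefish_edges_def symcl_def
        split: if_splits)
  have fin: "finite (pverts (cuttlefish n))"
    by (simp add: cuttlefish_def cuttlefish_vertices_def)
  have sym: "sym (parcs (cuttlefish n))"
    by (auto simp: cuttlefish_def symcl_def sym_def image_iff)
  have irr: "(x, x) \<notin> parcs (cuttlefish n)" for x
    using assms by (auto simp: cuttlefish_def cuttlefish_edges_def symcl_def split: if_splits)
  show ?thesis
  proof unfold_locales
    fix e assume "e \<in> parcs (cuttlefish n)"
    then show "fst e \<in> pverts (cuttlefish n)" "snd e \<in> pverts (cuttlefish n)"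
      using sub by auto
  next
    fix e assume "e \<in> parcs (cuttlefish n)"
    then show "fst e \<noteq> snd e"
      using irr by (metis prod.collapse)
  next
    show "finite (pverts (cuttlefish n))" by (rule fin)
    show "finite (parcs (cuttlefish n))"
      using sub fin by (meson finite_SigmaI finite_subset)
    show "symmetric (cuttlefish n)"
      using sym by (simp add: symmetric_def arcs_ends_def arc_to_ends_def)
  qed
qed

end

theory Submission
  imports Defs
begin

text \<open>
  Call a set \<open>C\<close> of vertices closed if every distance realised in the graph from a vertex of \<open>C\<close> is
  realised by a vertex of \<open>C\<close>; inside a closed set the Director can keep the token forever. The
  value of the game is therefore at most the size of any closed set containing the start, and the
  Explorer can go on until the visited vertices include a nonempty closed set. In \<open>CF_n\<close> every
  nonempty closed set has at least \<open>2 * (n div 2)\<close> elements. One pendant path together with the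
  adjacent half of the cycle is a closed set of that size, and so is its mirror image. These two
  sets cover all vertices, except for the one opposite to the edge between \<open>u_1\<close> and \<open>u_2\<close> when \<open>n\<close>
  is odd; a closed set containing that vertex is strictly larger.
\<close>

section \<open>Distances and closed sets\<close>

text \<open>A potential certifies shortest-path distances: \<open>lip\<close> keeps \<open>D\<close>
  below the length of every walk from \<open>u\<close>, and following \<open>pred\<close> back to
  \<open>u\<close> builds a walk of length \<open>D w\<close>. Two local checks thus replace an
  infimum over walks.\<close>

lemma (in wf_digraph) at_distance_eq:
  fixes D :: "'a \<Rightarrow> nat"
  assumes u: "u \<in> verts G" and "D u = 0"
    and lip: "\<And>a. a \<in> arcs G \<Longrightarrow> D (head G a) \<le> Suc (D (tail G a))"
    and pred: "\<And>w. w \<in> verts G \<Longrightarrow> w \<noteq> u \<Longrightarrow>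
      \<exists>a \<in> arcs G. head G a = w \<and> D w = Suc (D (tail G a))"
  shows "at_distance G u d = {w \<in> verts G. D w = d}"
proof -
  have cost: "awalk_cost (\<lambda>_. 1) p = real (length p)" for p :: "'b list"
    by (induction p) auto
  have lower: "D w \<le> D x + length p" if "awalk x p w" for x w p
    using that
  proof (induction p arbitrary: x)
    case Nil
    then show ?case by (simp add: awalk_Nil_iff)
  next
    case (Cons a p)
    then have "D w \<le> D (head G a) + length p" "a \<in> arcs G" "tail G a = x"
      by (auto simp: awalk_Cons_iff)
    then show ?case using lip[of a] by simp
  qed
  have upper: "\<exists>p. awalk u p w \<and> length p = D w" if "w \<in> verts G" for w
    using that
  proof (induction "D w" arbitrary: w)
    case 0
    then have "w = u" using pred[of w] by fastforce
    then show ?case using \<open>D u = 0\<close> u by (intro exI[of _ "[]"]) (simp add: awalk_Nil_iff)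
  next
    case (Suc k)
    then have "w \<noteq> u" using \<open>D u = 0\<close> by auto
    then obtain a where a: "a \<in> arcs G" "head G a = w" "D w = Suc (D (tail G a))"
      using pred[of w] Suc by blast
    then obtain p where p: "awalk u p (tail G a)" "length p = D (tail G a)"
      using Suc.hyps(1)[of "tail G a"] Suc.hyps(2) by auto
    have "awalk (tail G a) [a] w" using a by (auto simp: awalk_Cons_iff awalk_Nil_iff)
    then have "awalk u (p @ [a]) w" using p by auto
    then show ?case using p a by (intro exI[of _ "p @ [a]"]) simp
  qed
  have "\<mu> (\<lambda>_. 1) u w = ereal (real (D w))" if w: "w \<in> verts G" for w
  proof (rule antisym)
    show "\<mu> (\<lambda>_. 1) u w \<le> ereal (real (D w))"
      using upper[OF w] min_cost_le_walk_cost[of u _ w "\<lambda>_. 1"] cost by metis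
    show "ereal (real (D w)) \<le> \<mu> (\<lambda>_. 1) u w"
      unfolding \<mu>_def using lower[of u _ w] \<open>D u = 0\<close> by (intro INF_greatest) (simp add: cost)
  qed
  then show ?thesis unfolding at_distance_def by auto
qed

definition closed_set :: "('a, 'b) pre_digraph \<Rightarrow> 'a set \<Rightarrow> bool" where
  "closed_set G C \<longleftrightarrow>
     (\<forall>u \<in> C. \<forall>d. at_distance G u d \<noteq> {} \<longrightarrow> at_distance G u d \<inter> C \<noteq> {})"

text \<open>The witness is the set of all positions from which the Director can stay in
  \<open>S\<close>: unfolding \<open>can_stay\<close> once supplies answers of the same
  kind.\<close>

lemma can_stay_imp_closed_set:
  assumes "can_stay G S u"
  obtains C where "closed_set G C" "C \<subseteq> S" "u \<in> C"
proof
  show "closed_set G {u. can_stay G S u}"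
    unfolding closed_set_def by (auto elim: can_stay.cases)
  show "{u. can_stay G S u} \<subseteq> S" by (auto elim: can_stay.cases)
qed (use assms in simp)

lemma closed_set_imp_can_stay:
  assumes "closed_set G C" "C \<subseteq> S" "u \<in> C"
  shows "can_stay G S u"
  using assms(3)
proof (coinduction arbitrary: u)
  case can_stay
  then show ?case using assms(1,2) unfolding closed_set_def by blast
qed


section \<open>Strategies\<close>

text \<open>The Director answers inside \<open>C\<close> whenever possible. Started in
  \<open>C\<close>, the token never leaves it, no matter when the game ends.\<close>

lemma director_bound:
  assumes C: "closed_set G C" "C \<subseteq> verts G" "v \<in> C" and "finite C"
  shows "\<exists>\<delta> \<in> director_strategies G. \<forall>\<epsilon> \<in> explorer_strategies G. card (visited G \<epsilon> \<delta> v) \<le> card C"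
proof -
  \<comment> \<open>A strategy must be legal on every history, also where \<open>C\<close> offers no
    answer; hence the second branch.\<close>
  define \<delta> where "\<delta> h d =
    (if at_distance G (last h) d \<inter> C \<noteq> {} then SOME w. w \<in> at_distance G (last h) d \<inter> C
     else SOME w. w \<in> at_distance G (last h) d)" for h d
  have in_C: "\<delta> h d \<in> at_distance G (last h) d \<inter> C" if "at_distance G (last h) d \<inter> C \<noteq> {}" for h d
    using that some_in_eq[of "at_distance G (last h) d \<inter> C"] unfolding \<delta>_def by auto
  have "\<delta> h d \<in> at_distance G (last h) d" if "at_distance G (last h) d \<noteq> {}" for h d
    using that some_in_eq[of "at_distance G (last h) d"] in_C[of h d] unfolding \<delta>_def
    by (cases "at_distance G (last h) d \<inter> C = {}") auto
  then have "\<delta> \<in> director_strategies G" unfolding director_strategies_def by blast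
  moreover have "card (visited G \<epsilon> \<delta> v) \<le> card C" if \<epsilon>: "\<epsilon> \<in> explorer_strategies G" for \<epsilon>
  proof -
    have hist: "history \<epsilon> \<delta> v t \<noteq> [] \<and> set (history \<epsilon> \<delta> v t) \<subseteq> C" for t
    proof (induction t)
      case 0
      then show ?case using C by simp
    next
      case (Suc t)
      let ?h = "history \<epsilon> \<delta> v t"
      have "?h \<in> histories G" using Suc C by (auto simp: histories_def)
      then have "at_distance G (last ?h) (\<epsilon> ?h) \<noteq> {}" using \<epsilon> by (auto simp: explorer_strategies_def)
      moreover have "last ?h \<in> C" using Suc last_in_set by blast
      ultimately have "at_distance G (last ?h) (\<epsilon> ?h) \<inter> C \<noteq> {}"
        using C(1) unfolding closed_set_def by blast
      from in_C[OF this] show ?case using Suc by simp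
    qed
    then have "token \<epsilon> \<delta> v t \<in> C" for t unfolding token_def by (meson last_in_set subsetD)
    then have "visited G \<epsilon> \<delta> v \<subseteq> C" unfolding visited_def by auto
    then show ?thesis using \<open>finite C\<close> card_mono by blast
  qed
  ultimately show ?thesis by blast
qed

text \<open>Finite-horizon approximants of the complement of \<open>can_stay\<close>: the Explorer
  can drive the token out of \<open>S\<close> within \<open>k\<close> moves.\<close>

primrec forces_exit :: "('a, 'b) pre_digraph \<Rightarrow> 'a set \<Rightarrow> nat \<Rightarrow> 'a \<Rightarrow> bool" where
  "forces_exit G S 0 u \<longleftrightarrow> u \<notin> S"
| "forces_exit G S (Suc k) u \<longleftrightarrow> u \<notin> S \<or>
     (\<exists>d. at_distance G u d \<noteq> {} \<and> (\<forall>w \<in> at_distance G u d. forces_exit G S k w))"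

lemma forces_exit_mono: "forces_exit G S k u \<Longrightarrow> k \<le> l \<Longrightarrow> forces_exit G S l u"
proof (induction k arbitrary: u l)
  case 0
  then show ?case by (cases l) auto
next
  case (Suc k)
  then obtain l' where "l = Suc l'" "k \<le> l'" by (cases l) auto
  with Suc show ?case by auto
qed

text \<open>Positions without a finite exit time satisfy the coinduction rule of
  \<open>can_stay\<close>. Finiteness enters because the finitely many answers to a distance have a
  common bound on their exit times, if they all have one.\<close>

lemma not_can_stay_imp_forces_exit:
  assumes "finite (verts G)" "\<not> can_stay G S u"
  shows "\<exists>k. forces_exit G S k u"
proof (rule ccontr)
  assume "\<not> ?thesis"
  then have "can_stay G S u"
  proof (coinduction arbitrary: u)
    case can_stay
    then have "\<not> forces_exit G S 0 u" by blast
    then have "u \<in> S" by simp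
    moreover have "\<exists>w \<in> at_distance G u d. \<forall>k. \<not> forces_exit G S k w"
      if d: "at_distance G u d \<noteq> {}" for d
    proof (rule ccontr)
      assume "\<not> ?thesis"
      then have "\<forall>w \<in> at_distance G u d. \<exists>k. forces_exit G S k w" by blast
      then obtain f where f: "\<And>w. w \<in> at_distance G u d \<Longrightarrow> forces_exit G S (f w) w"
        unfolding bchoice_iff by blast
      have "finite (at_distance G u d)" using assms(1) by (simp add: at_distance_def)
      then have "forces_exit G S (Max (f ` at_distance G u d)) w" if "w \<in> at_distance G u d" for w
        using forces_exit_mono[OF f[OF that]] that by simp
      then have "forces_exit G S (Suc (Max (f ` at_distance G u d))) u" using d by auto
      with can_stay show False by blast
    qed
    ultimately show ?case by auto
  qed
  with assms(2) show False by blast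
qed

text \<open>
  As long as the game is not over, the Explorer names a distance that shortens the time needed to
  force the token out of the set of visited vertices.
\<close>

lemma explorer_bound:
  assumes fin: "finite (verts G)" and v: "v \<in> verts G"
    and move: "\<And>u. u \<in> verts G \<Longrightarrow> \<exists>d. at_distance G u d \<noteq> {}"
    and bound: "\<And>S u. S \<subseteq> verts G \<Longrightarrow> v \<in> S \<Longrightarrow> can_stay G S u \<Longrightarrow> k \<le> card S"
  shows "\<exists>\<epsilon> \<in> explorer_strategies G. \<forall>\<delta> \<in> director_strategies G. k \<le> card (visited G \<epsilon> \<delta> v)"
proof -
  define rank where "rank S u = (LEAST k. forces_exit G S k u)" for S u
  \<comment> \<open>Only positions in \<open>S\<close> where the game is not over are constrained;
    elsewhere any legal distance will do, so a choice exists for every history.\<close>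
  define good where "good S u d \<longleftrightarrow> at_distance G u d \<noteq> {} \<and>
    (\<not> can_stay G S u \<longrightarrow> u \<in> S \<longrightarrow>
      (\<forall>w \<in> at_distance G u d. \<exists>k < rank S u. forces_exit G S k w))" for S u d
  have ex_good: "\<exists>d. good S u d" if u: "u \<in> verts G" for S u
  proof (cases "\<not> can_stay G S u \<and> u \<in> S")
    case True
    then have "forces_exit G S (rank S u) u"
      unfolding rank_def using not_can_stay_imp_forces_exit[OF fin] LeastI_ex by metis
    \<comment> \<open>Rank 0 would put \<open>u\<close> outside \<open>S\<close>, so the rank is
      some \<open>Suc k\<close> and \<open>forces_exit\<close> names a distance after which
      \<open>k\<close> moves suffice.\<close>
    with True obtain d where "at_distance G u d \<noteq> {}"
      "\<forall>w \<in> at_distance G u d. \<exists>k < rank S u. forces_exit G S k w"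
      by (cases "rank S u") auto
    then show ?thesis unfolding good_def by blast
  next
    case False
    then show ?thesis using move[OF u] unfolding good_def by blast
  qed
  define \<epsilon> where "\<epsilon> h = (SOME d. good (set h) (last h) d)" for h
  have \<epsilon>: "good (set h) (last h) (\<epsilon> h)" if "h \<in> histories G" for h
  proof -
    have "last h \<in> verts G" using that by (auto simp: histories_def)
    from ex_good[OF this] show ?thesis unfolding \<epsilon>_def by (rule someI_ex)
  qed
  have "\<epsilon> \<in> explorer_strategies G"
    using \<epsilon> unfolding explorer_strategies_def good_def by blast
  moreover have "k \<le> card (visited G \<epsilon> \<delta> v)" if \<delta>: "\<delta> \<in> director_strategies G" for \<delta>
  proof -
    let ?H = "history \<epsilon> \<delta> v" and ?T = "token \<epsilon> \<delta> v"
    have next_token: "?T (Suc t) = \<delta> (?H t) (\<epsilon> (?H t))" for t by (simp add: token_def)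
    have next_at: "\<delta> h (\<epsilon> h) \<in> at_distance G (last h) (\<epsilon> h)" if "h \<in> histories G" for h
      using \<delta> \<epsilon>[OF that] that unfolding director_strategies_def good_def by blast
    have hist: "?H t \<in> histories G" for t
    proof (induction t)
      case 0
      then show ?case using v by (simp add: histories_def)
    next
      case (Suc t)
      have "at_distance G x d \<subseteq> verts G" for x d by (auto simp: at_distance_def)
      with next_at[OF Suc] Suc show ?case by (auto simp: histories_def)
    qed
    have set_hist: "set (?H t) = ?T ` {..t}" for t
    proof (induction t)
      case (Suc t)
      then show ?case by (simp add: atMost_Suc next_token)
    qed (simp add: token_def)
    have range: "?T ` A \<subseteq> verts G" for A
      using hist last_in_set unfolding histories_def token_def by fastforce
    have "\<exists>t. game_over G \<epsilon> \<delta> v t"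
    proof (rule ccontr)
      assume never: "\<not> ?thesis"
      define S where "S = range ?T"
      have "finite S" unfolding S_def using range fin finite_subset by blast
      then obtain I where I: "finite I" "S = ?T ` I"
        unfolding S_def using finite_subset_image[of "range ?T" ?T UNIV] by auto
      \<comment> \<open>From time \<open>N\<close> on no new vertex appears, so all ranks refer to
        the same set \<open>S\<close> and would decrease forever.\<close>
      define N where "N = Max (insert 0 I)"
      have S_eq: "?T ` {..t} = S" if "t \<ge> N" for t
      proof
        show "?T ` {..t} \<subseteq> S" unfolding S_def by blast
        have "i \<le> t" if "i \<in> I" for i
          using I(1) that \<open>t \<ge> N\<close> Max_ge[of "insert 0 I" i] unfolding N_def by simp
        then show "S \<subseteq> ?T ` {..t}" unfolding I(2) by auto
      qed
      have decr: "rank S (?T (Suc t)) < rank S (?T t)" if t: "t \<ge> N" for t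
      proof -
        let ?h = "?H t"
        have "set ?h = S" "last ?h = ?T t" using set_hist[of t] S_eq[OF t] by (auto simp: token_def)
        moreover have "\<not> can_stay G S (?T t)" using never S_eq[OF t] by (auto simp: game_over_def)
        moreover have "?T t \<in> S" unfolding S_def by blast
        ultimately have "\<forall>w \<in> at_distance G (?T t) (\<epsilon> ?h). \<exists>k < rank S (?T t). forces_exit G S k w"
          using \<epsilon>[OF hist[of t]] unfolding good_def by simp
        moreover have "?T (Suc t) \<in> at_distance G (?T t) (\<epsilon> ?h)"
          using next_at[OF hist[of t]] \<open>last ?h = ?T t\<close> next_token by simp
        ultimately obtain k where "k < rank S (?T t)" "forces_exit G S k (?T (Suc t))" by blast
        then show ?thesis unfolding rank_def using Least_le le_less_trans by metis
      qed
      have "\<exists>i. \<not> rank S (?T (N + Suc i)) < rank S (?T (N + i))"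
        using wf_no_infinite_down_chainE[OF wf_less, of "\<lambda>i. rank S (?T (N + i))"] by auto
      then show False using decr by auto
    qed
    then obtain t where t: "game_over G \<epsilon> \<delta> v t" "\<forall>s < t. \<not> game_over G \<epsilon> \<delta> v s"
      using exists_least_iff[of "game_over G \<epsilon> \<delta> v"] by auto
    \<comment> \<open>Time \<open>r\<close> counts if the game is not over before \<open>r\<close>,
      so the position at the first final time \<open>t\<close> is included.\<close>
    then have "(\<forall>s < r. \<not> game_over G \<epsilon> \<delta> v s) \<longleftrightarrow> r \<le> t" for r
      by (meson leI less_le_trans)
    then have "visited G \<epsilon> \<delta> v = ?T ` {..t}"
      unfolding visited_def by auto
    moreover have "v \<in> ?T ` {..t}"
      by (rule image_eqI[of _ _ 0]) (auto simp: token_def)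
    ultimately show ?thesis using bound[OF range] t(1) unfolding game_over_def by metis
  qed
  ultimately show ?thesis by blast
qed


section \<open>Distances in cuttlefish graphs\<close>

text \<open>Coordinates of a vertex: the index of the cycle vertex below it and its distance from
  the cycle.\<close>

primrec base :: "cf_vertex \<Rightarrow> nat" where
  "base (U i) = i"
| "base (V i) = 1"
| "base (W i) = 2"

primrec height :: "cf_vertex \<Rightarrow> nat" where
  "height (U i) = 0"
| "height (V i) = i"
| "height (W i) = i"

text \<open>In a sum \<open>(i - j) + (j - i)\<close> of truncated differences one summand is 0.\<close>

definition cycle_dist :: "nat \<Rightarrow> nat \<Rightarrow> nat \<Rightarrow> nat" where
  "cycle_dist n i j = min ((i - j) + (j - i)) (n - ((i - j) + (j - i)))"

text \<open>Vertices with equal base lie on one path issuing from the cycle; otherwise a route must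
  lead down to the cycle, along it, and up again.\<close>

definition cf_dist :: "nat \<Rightarrow> cf_vertex \<Rightarrow> cf_vertex \<Rightarrow> nat" where
  "cf_dist n x y =
     (if base x = base y then (height x - height y) + (height y - height x)
      else height x + height y + cycle_dist n (base x) (base y))"

lemma U_mem_cuttlefish: "U i \<in> pverts (cuttlefish n) \<longleftrightarrow> 1 \<le> i \<and> i \<le> n"
  and V_mem_cuttlefish: "V i \<in> pverts (cuttlefish n) \<longleftrightarrow> 1 \<le> i \<and> i \<le> n div 2 - 1"
  and W_mem_cuttlefish: "W i \<in> pverts (cuttlefish n) \<longleftrightarrow> 1 \<le> i \<and> i \<le> n div 2 - 1"
  by (auto simp: cuttlefish_def cuttlefish_vertices_def)

lemmas mem_cuttlefish = U_mem_cuttlefish V_mem_cuttlefish W_mem_cuttlefish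

lemma parcs_cuttlefish_commute:
  "(x, y) \<in> parcs (cuttlefish n) \<longleftrightarrow> (y, x) \<in> parcs (cuttlefish n)"
  by (auto simp: cuttlefish_def symcl_def image_iff)

lemma edges_cuttlefish:
  "1 \<le> i \<Longrightarrow> i < n \<Longrightarrow> (U i, U (Suc i)) \<in> parcs (cuttlefish n)"
  "(U n, U (Suc 0)) \<in> parcs (cuttlefish n)"
  "1 \<le> n div 2 - 1 \<Longrightarrow> (U (Suc 0), V (Suc 0)) \<in> parcs (cuttlefish n)"
  "1 \<le> i \<Longrightarrow> i \<le> n div 2 - 2 \<Longrightarrow> (V i, V (Suc i)) \<in> parcs (cuttlefish n)"
  "1 \<le> n div 2 - 1 \<Longrightarrow> (U 2, W (Suc 0)) \<in> parcs (cuttlefish n)"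
  "1 \<le> i \<Longrightarrow> i \<le> n div 2 - 2 \<Longrightarrow> (W i, W (Suc i)) \<in> parcs (cuttlefish n)"
  by (auto simp: cuttlefish_def cuttlefish_edges_def symcl_def)

lemma cycle_dist_step:
  assumes "1 \<le> b" "b \<le> n"
  shows "i < n \<Longrightarrow> cycle_dist n b (Suc i) \<le> Suc (cycle_dist n b i)"
    and "i < n \<Longrightarrow> cycle_dist n b i \<le> Suc (cycle_dist n b (Suc i))"
    and "cycle_dist n b (Suc 0) \<le> Suc (cycle_dist n b n)"
    and "cycle_dist n b n \<le> Suc (cycle_dist n b (Suc 0))"
  using assms unfolding cycle_dist_def by linarith+

lemma cf_dist_U: "u \<in> pverts (cuttlefish n) \<Longrightarrow> cf_dist n u (U i) = height u + cycle_dist n (base u) i"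
  by (auto simp: cf_dist_def cycle_dist_def)

text \<open>An edge joins cyclic neighbours or raises the height by one over a fixed base. Both
  inequalities are needed for \<open>lip\<close>, as \<open>cuttlefish_edges\<close> lists each edge
  once.\<close>

lemma cf_dist_edge:
  assumes "n \<ge> 5" "u \<in> pverts (cuttlefish n)" "(x, y) \<in> cuttlefish_edges n"
  shows "cf_dist n u y \<le> Suc (cf_dist n u x) \<and> cf_dist n u x \<le> Suc (cf_dist n u y)"
proof -
  have b: "1 \<le> base u" "base u \<le> n"
    using assms(1,2) by (cases u; simp add: mem_cuttlefish)+
  note step = cycle_dist_step[OF b]
  from assms(3) consider i where "x = U i" "y = U (Suc i)" "i < n" | "x = U n" "y = U (Suc 0)"
    | (same_base) "base x = base y" "height y = Suc (height x)"
    unfolding cuttlefish_edges_def by (fastforce split: if_splits)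
  then show ?thesis
  proof cases
    case same_base
    then show ?thesis by (auto simp: cf_dist_def)
  qed (use step in \<open>simp_all add: cf_dist_U assms(2)\<close>)
qed

lemma cycle_dist_pred:
  assumes "1 \<le> b" "b \<le> n" "1 \<le> k" "k \<le> n" "b \<noteq> k"
  shows "cycle_dist n b k = Suc (cycle_dist n b (if k = 1 then n else k - 1)) \<or>
    cycle_dist n b k = Suc (cycle_dist n b (if k = n then 1 else Suc k))"
proof (cases "b < k")
  case True
  then obtain d where d: "k = Suc (b + d)" using less_imp_Suc_add by blast
  show ?thesis
  \<comment> \<open>\<open>Suc d\<close> is the length of the arc avoiding the edge between
    \<open>n\<close> and \<open>1\<close>. If it is at most half the cycle, step back along it;
    otherwise step along the other arc.\<close>
  proof (cases "2 * Suc d \<le> n")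
    case True
    then show ?thesis using assms d by (auto simp: cycle_dist_def min_def)
  next
    case False
    then show ?thesis using assms d by (intro disjI2) (auto simp: cycle_dist_def min_def)
  qed
next
  case False
  then obtain d where d: "b = Suc (k + d)" using less_imp_Suc_add assms(5) nat_neq_iff by metis
  show ?thesis
  proof (cases "2 * Suc d \<le> n")
    case True
    then show ?thesis using assms d by (intro disjI2) (auto simp: cycle_dist_def min_def)
  next
    case False
    then show ?thesis using assms d by (intro disjI1) (auto simp: cycle_dist_def min_def)
  qed
qed

text \<open>This supplies \<open>pred\<close>. The vertex before \<open>w\<close> is a cyclic
  neighbour if \<open>w\<close> is on the cycle and not the base of \<open>u\<close>, the first
  vertex of the pendant path of \<open>u\<close> if \<open>w\<close> is its base, and on a pendant
  path the outer neighbour if \<open>u\<close> lies further out on it, else the inner one.\<close>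

lemma cf_dist_pred:
  assumes n: "n \<ge> 5" and u: "u \<in> pverts (cuttlefish n)"
    and w: "w \<in> pverts (cuttlefish n)" "w \<noteq> u"
  shows "\<exists>x. (x, w) \<in> parcs (cuttlefish n) \<and> cf_dist n u w = Suc (cf_dist n u x)"
proof (cases w)
  case (U k)
  have b: "1 \<le> base u" "base u \<le> n"
    using n u by (cases u; simp add: mem_cuttlefish)+
  have k: "1 \<le> k" "k \<le> n" using w U by (auto simp: mem_cuttlefish)
  define p where "p = (if k = 1 then n else k - 1)"
  define s where "s = (if k = n then 1 else Suc k)"
  have p: "(U p, U k) \<in> parcs (cuttlefish n)"
    using k edges_cuttlefish(1)[of "k - 1" n] edges_cuttlefish(2)[of n] by (auto simp: p_def)
  have s: "(U s, U k) \<in> parcs (cuttlefish n)"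
    using k edges_cuttlefish(1)[of k n] edges_cuttlefish(2)[of n] parcs_cuttlefish_commute
    by (auto simp: s_def)
  show ?thesis
  proof (cases "base u = k")
    case True
    show ?thesis
    proof (cases u)
      case (V l)
      then have "(V 1, w) \<in> parcs (cuttlefish n)"
        using True U u edges_cuttlefish(3)[of n] parcs_cuttlefish_commute
        by (auto simp: mem_cuttlefish)
      then show ?thesis using True U V u
        by (intro exI[of _ "V 1"]) (auto simp: mem_cuttlefish cf_dist_def)
    next
      case (W l)
      then have "(W 1, w) \<in> parcs (cuttlefish n)"
        using True U u edges_cuttlefish(5)[of n] parcs_cuttlefish_commute
        by (auto simp: mem_cuttlefish)
      then show ?thesis using True U W u
        by (intro exI[of _ "W 1"]) (auto simp: mem_cuttlefish cf_dist_def)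
    qed (use True U w in auto)
  next
    case False
    then have "cf_dist n u w = Suc (cf_dist n u (U p)) \<or> cf_dist n u w = Suc (cf_dist n u (U s))"
      unfolding U cf_dist_U[OF u] using cycle_dist_pred[OF b k False] p_def s_def by simp
    with p s U show ?thesis by auto
  qed
next
  case (V j)
  show ?thesis
  proof (cases "base u = 1 \<and> j < height u")
    case True
    then have "(V (Suc j), w) \<in> parcs (cuttlefish n)"
      using V n u w edges_cuttlefish(4)[of j n] parcs_cuttlefish_commute
      by (cases u) (auto simp: mem_cuttlefish)
    with True V show ?thesis
      by (intro exI[of _ "V (Suc j)"]) (auto simp: cf_dist_def)
  next
    case False
    define x where "x = (if j = 1 then U 1 else V (j - 1))"
    have "(x, w) \<in> parcs (cuttlefish n)"
      using V n w edges_cuttlefish(3)[of n] edges_cuttlefish(4)[of "j - 1" n]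
      by (auto simp: mem_cuttlefish x_def)
    moreover have "cf_dist n u w = Suc (cf_dist n u x)"
      using False V w u by (cases u) (auto simp: mem_cuttlefish cf_dist_def x_def)
    ultimately show ?thesis by blast
  qed
next
  case (W j)
  show ?thesis
  proof (cases "base u = 2 \<and> j < height u")
    case True
    then have "(W (Suc j), w) \<in> parcs (cuttlefish n)"
      using W n u w edges_cuttlefish(6)[of j n] parcs_cuttlefish_commute
      by (cases u) (auto simp: mem_cuttlefish)
    with True W show ?thesis
      by (intro exI[of _ "W (Suc j)"]) (auto simp: cf_dist_def)
  next
    case False
    define x where "x = (if j = 1 then U 2 else W (j - 1))"
    have "(x, w) \<in> parcs (cuttlefish n)"
      using W n w edges_cuttlefish(5)[of n] edges_cuttlefish(6)[of "j - 1" n]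
      by (auto simp: mem_cuttlefish x_def)
    moreover have "cf_dist n u w = Suc (cf_dist n u x)"
      using False W w u by (cases u) (auto simp: mem_cuttlefish cf_dist_def x_def)
    ultimately show ?thesis by blast
  qed
qed

section \<open>The game distances and closed sets in terms of \<open>cf_dist\<close>\<close>

lemma at_distance_cuttlefish:
  assumes n: "n \<ge> 5" and u: "u \<in> pverts (cuttlefish n)"
  shows "at_distance (cuttlefish n) u d = {w \<in> pverts (cuttlefish n). cf_dist n u w = d}"
proof -
  interpret pair_graph "cuttlefish n" using n by (intro cuttlefish_pair_graph) simp
  have "at_distance (cuttlefish n) u d =
    {w \<in> verts (with_proj (cuttlefish n)). cf_dist n u w = d}"
  proof (rule wf_digraph.at_distance_eq[where D = "cf_dist n u"])
    show "wf_digraph (with_proj (cuttlefish n))" by unfold_locales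
  next
    show "cf_dist n u u = 0" by (simp add: cf_dist_def)
  next
    fix a assume "a \<in> arcs (with_proj (cuttlefish n))"
    then show "cf_dist n u (head (with_proj (cuttlefish n)) a)
      \<le> Suc (cf_dist n u (tail (with_proj (cuttlefish n)) a))"
      using cf_dist_edge[OF n u] by (auto simp: cuttlefish_def symcl_def)
  next
    fix w assume "w \<in> verts (with_proj (cuttlefish n))" "w \<noteq> u"
    with cf_dist_pred[OF n u] show "\<exists>a \<in> arcs (with_proj (cuttlefish n)).
      head (with_proj (cuttlefish n)) a = w \<and>
      cf_dist n u w = Suc (cf_dist n u (tail (with_proj (cuttlefish n)) a))"
      by force
  qed (use u in simp)
  then show ?thesis by simp
qed

lemma closed_set_cuttlefish_iff:
  assumes n: "n \<ge> 5" and "C \<subseteq> pverts (cuttlefish n)"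
  shows "closed_set (cuttlefish n) C \<longleftrightarrow>
    (\<forall>u \<in> C. \<forall>w \<in> pverts (cuttlefish n). \<exists>c \<in> C. cf_dist n u c = cf_dist n u w)"
proof -
  have "at_distance (cuttlefish n) u d = {w \<in> pverts (cuttlefish n). cf_dist n u w = d}"
    if "u \<in> C" for u d
    using at_distance_cuttlefish[OF n] that assms(2) by blast
  then show ?thesis using assms(2) unfolding closed_set_def by fastforce
qed

text \<open>Stepping back from \<open>w\<close> along \<open>cf_dist_pred\<close> lowers the
  distance one by one, so no value is skipped.\<close>

lemma cf_dist_downward:
  assumes n: "n \<ge> 5" and u: "u \<in> pverts (cuttlefish n)"
    and w: "w \<in> pverts (cuttlefish n)" "d \<le> cf_dist n u w"
  shows "\<exists>x \<in> pverts (cuttlefish n). cf_dist n u x = d"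
  using w
proof (induction "cf_dist n u w" arbitrary: w rule: less_induct)
  case less
  interpret pair_graph "cuttlefish n" using n by (intro cuttlefish_pair_graph) simp
  show ?case
  proof (cases "d = cf_dist n u w")
    case False
    then have "w \<noteq> u" using less.prems by (auto simp: cf_dist_def)
    then obtain x where x: "(x, w) \<in> parcs (cuttlefish n)" "cf_dist n u w = Suc (cf_dist n u x)"
      using cf_dist_pred[OF n u less.prems(1)] by blast
    then have "x \<in> pverts (cuttlefish n)" using in_arcsD1 by blast
    then show ?thesis using x False less.prems less.hyps[of x] by simp
  qed (use less in blast)
qed

section \<open>Cycle distances and the reflection symmetry\<close>

lemma cycle_dist_commute: "cycle_dist n i j = cycle_dist n j i"
  by (simp add: cycle_dist_def add.commute)

lemma cycle_dist_le: "cycle_dist n i j \<le> n div 2"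
  unfolding cycle_dist_def by linarith

lemma cycle_dist_add: "d \<le> n div 2 \<Longrightarrow> cycle_dist n i (i + d) = d"
  unfolding cycle_dist_def by simp

text \<open>The automorphism that extends the reflection \<open>i \<mapsto> 3 - i\<close> (modulo \<open>n\<close>) of the cycle.\<close>

primrec mirror :: "nat \<Rightarrow> cf_vertex \<Rightarrow> cf_vertex" where
  "mirror n (U i) = U (if i \<le> 2 then 3 - i else n + 3 - i)"
| "mirror n (V i) = W i"
| "mirror n (W i) = V i"

lemma mirror_mem: "n \<ge> 2 \<Longrightarrow> x \<in> pverts (cuttlefish n) \<Longrightarrow> mirror n x \<in> pverts (cuttlefish n)"
  by (cases x) (auto simp: mem_cuttlefish)

lemma mirror_mirror: "x \<in> pverts (cuttlefish n) \<Longrightarrow> mirror n (mirror n x) = x"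
  by (cases x) (auto simp: mem_cuttlefish)

lemma inj_on_mirror: "inj_on (mirror n) (pverts (cuttlefish n))"
  by (metis inj_onI mirror_mirror)

lemma base_mem_cuttlefish:
  "n \<ge> 2 \<Longrightarrow> x \<in> pverts (cuttlefish n) \<Longrightarrow> 1 \<le> base x \<and> base x \<le> n"
  by (cases x) (auto simp: mem_cuttlefish)

lemma cf_dist_mirror:
  assumes n: "n \<ge> 2" and x: "x \<in> pverts (cuttlefish n)" and y: "y \<in> pverts (cuttlefish n)"
  shows "cf_dist n (mirror n x) (mirror n y) = cf_dist n x y"
proof -
  \<comment> \<open>\<open>mirror\<close> acts on bases by the reflection \<open>r\<close> and keeps
    heights, and \<open>cf_dist\<close> depends on nothing else.\<close>
  define r where "r i = (if i \<le> 2 then 3 - i else n + 3 - i)" for i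
  have base: "base (mirror n z) = r (base z)" "height (mirror n z) = height z"
    if "z \<in> pverts (cuttlefish n)" for z
    using that by (cases z; simp add: r_def)+
  have cyc: "cycle_dist n (r i) (r j) = cycle_dist n i j" if "i < j" "1 \<le> i" "j \<le> n" for i j
    using that by (cases "i \<le> 2"; cases "j \<le> 2") (auto simp: r_def cycle_dist_def min_def)
  have "cycle_dist n (r i) (r j) = cycle_dist n i j"
    if "1 \<le> i" "1 \<le> j" "i \<le> n" "j \<le> n" for i j
    using that cyc[of i j] cyc[of j i] cycle_dist_commute
    by (cases i j rule: linorder_cases) (auto simp: cycle_dist_def)
  moreover have "r i = r j \<longleftrightarrow> i = j" if "1 \<le> i" "1 \<le> j" "i \<le> n" "j \<le> n" for i j
    using that by (auto simp: r_def split: if_splits)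
  ultimately show ?thesis
    unfolding cf_dist_def using base x y base_mem_cuttlefish[OF n] by simp
qed

lemma closed_set_mirror:
  assumes n: "n \<ge> 5" and C: "closed_set (cuttlefish n) C" "C \<subseteq> pverts (cuttlefish n)"
  shows "closed_set (cuttlefish n) (mirror n ` C)"
proof -
  have n2: "n \<ge> 2" using n by simp
  have "\<exists>c \<in> mirror n ` C. cf_dist n (mirror n u) c = cf_dist n (mirror n u) w"
    if u: "u \<in> C" and w: "w \<in> pverts (cuttlefish n)" for u w
  proof -
    obtain c where c: "c \<in> C" "cf_dist n u c = cf_dist n u (mirror n w)"
      using C u mirror_mem[OF n2 w] closed_set_cuttlefish_iff[OF n] by blast
    then have "cf_dist n (mirror n u) (mirror n c) = cf_dist n (mirror n u) (mirror n (mirror n w))"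
      using cf_dist_mirror[OF n2] C(2) u mirror_mem[OF n2 w] by (metis subsetD)
    with c mirror_mirror[OF w] show ?thesis by auto
  qed
  moreover have "mirror n ` C \<subseteq> pverts (cuttlefish n)" using C(2) mirror_mem[OF n2] by blast
  ultimately show ?thesis using closed_set_cuttlefish_iff[OF n] by blast
qed

lemma finite_cuttlefish: "finite (pverts (cuttlefish n))"
  by (simp add: cuttlefish_def cuttlefish_vertices_def)

section \<open>Closed sets in cuttlefish graphs\<close>

lemma closed_reaches:
  assumes n: "n \<ge> 5" and C: "closed_set (cuttlefish n) C" "C \<subseteq> pverts (cuttlefish n)"
    and p: "p \<in> C" and q: "q \<in> pverts (cuttlefish n)" "d \<le> cf_dist n p q"
  shows "\<exists>c \<in> C. c \<in> pverts (cuttlefish n) \<and> cf_dist n p c = d"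
proof -
  obtain w where "w \<in> pverts (cuttlefish n)" "cf_dist n p w = d"
    using cf_dist_downward[OF n _ q] C(2) p by blast
  then obtain c where "c \<in> C" "cf_dist n p c = d"
    using C p closed_set_cuttlefish_iff[OF n] by blast
  then show ?thesis using C(2) by blast
qed

text \<open>The image of \<open>C\<close> under \<open>cf_dist n p\<close> contains all values up to
  \<open>cf_dist n p q\<close>. If two elements collide, deleting one leaves the image unchanged,
  which gains one in the bound.\<close>

lemma card_closed_ge:
  assumes "n \<ge> 5" "closed_set (cuttlefish n) C" "C \<subseteq> pverts (cuttlefish n)" "finite C"
    and "p \<in> C" "q \<in> pverts (cuttlefish n)"
  shows "Suc (cf_dist n p q) \<le> card C"
    and "a \<in> C \<Longrightarrow> b \<in> C \<Longrightarrow> a \<noteq> b \<Longrightarrow> cf_dist n p a = cf_dist n p b \<Longrightarrow>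
      Suc (Suc (cf_dist n p q)) \<le> card C"
proof -
  have sub: "{..cf_dist n p q} \<subseteq> cf_dist n p ` C"
    using closed_reaches[OF assms(1-3,5,6)] by (fastforce simp: image_iff)
  have le: "Suc (cf_dist n p q) \<le> card B" if "finite B" "{..cf_dist n p q} \<subseteq> cf_dist n p ` B" for B
    using that surj_card_le[of B "{..cf_dist n p q}" "cf_dist n p"] by simp
  show "Suc (cf_dist n p q) \<le> card C" using le sub assms(4) by blast
  assume ab: "a \<in> C" "b \<in> C" "a \<noteq> b" "cf_dist n p a = cf_dist n p b"
  then have "cf_dist n p ` (C - {a}) = cf_dist n p ` C" by (auto simp: image_iff)
  then have "Suc (cf_dist n p q) \<le> card (C - {a})" using le[of "C - {a}"] sub assms(4) by simp
  moreover have "card C = Suc (card (C - {a}))" using ab(1) assms(4) by (metis card.remove)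
  ultimately show "Suc (Suc (cf_dist n p q)) \<le> card C" by simp
qed

text \<open>
  From any position the Explorer can move the token to an end of a pendant path or to an antipode
  of \<open>U 1\<close> or \<open>U 2\<close>; those vertices have eccentricity \<open>2 * (n div 2) - 1\<close>, and a closed set contains
  a vertex at each smaller distance from them.
\<close>

lemma card_closed:
  assumes n: "n \<ge> 5" and C: "closed_set (cuttlefish n) C" "C \<subseteq> pverts (cuttlefish n)"
    and "C \<noteq> {}"
  shows "2 * (n div 2) \<le> card C"
proof -
  have fin: "finite C" using C(2) finite_cuttlefish finite_subset by blast
  define m where "m = n div 2"
  have m: "m \<ge> 2" "n = 2 * m \<or> n = 2 * m + 1" using n by (auto simp: m_def)
  define far where "far c \<longleftrightarrow> (\<exists>q \<in> pverts (cuttlefish n). 2 * m \<le> Suc (cf_dist n c q))" for c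
  \<comment> \<open>The cycle vertices here are the antipodes of \<open>U 1\<close> and
    \<open>U 2\<close>; \<open>n + 2 - m\<close> is \<open>m + 2\<close> for even \<open>n\<close>
    and \<open>m + 3\<close> for odd \<open>n\<close>.\<close>
  have far: "far (V (m - 1))" "far (W (m - 1))" "far (U (m + 1))" "far (U (m + 2))" "far (U (n + 2 - m))"
  proof -
    show "far (V (m - 1))" unfolding far_def
      using m by (intro bexI[of _ "W (m - 1)"]) (auto simp: mem_cuttlefish cf_dist_def cycle_dist_def)
    show "far (W (m - 1))" unfolding far_def
      using m by (intro bexI[of _ "V (m - 1)"]) (auto simp: mem_cuttlefish cf_dist_def cycle_dist_def)
    show "far (U (m + 1))" unfolding far_def
      using m by (intro bexI[of _ "V (m - 1)"]) (auto simp: mem_cuttlefish cf_dist_def cycle_dist_def)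
    show "far (U (m + 2))" unfolding far_def
      using m by (intro bexI[of _ "W (m - 1)"]) (auto simp: mem_cuttlefish cf_dist_def cycle_dist_def)
    show "far (U (n + 2 - m))" unfolding far_def
      using m by (intro bexI[of _ "W (m - 1)"]) (auto simp: mem_cuttlefish cf_dist_def cycle_dist_def)
  qed
  have end_V: "far (V j)" if "V j \<in> pverts (cuttlefish n)" "m - 1 \<le> j" for j
    using that far(1) by (auto simp: mem_cuttlefish m_def)
  have end_W: "far (W j)" if "W j \<in> pverts (cuttlefish n)" "m - 1 \<le> j" for j
    using that far(2) by (auto simp: mem_cuttlefish m_def)
  have antipode: "far (U k)" if "cycle_dist n i k \<ge> m" "i = 1 \<or> i = 2" "1 \<le> k" "k \<le> n" for i k
  proof -
    have "i + m \<le> k \<and> k + m \<le> n + i"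
      using that m unfolding cycle_dist_def min.bounded_iff by linarith
    then have "k = m + 1 \<or> k = m + 2 \<or> k = n + 2 - m" using that(2) m by linarith
    then show ?thesis using far by blast
  qed
  obtain u where u: "u \<in> C" using \<open>C \<noteq> {}\<close> by blast
  then have u': "u \<in> pverts (cuttlefish n)" using C(2) by blast
  \<comment> \<open>One move suffices: some realised distance from \<open>u\<close> leads to far
    vertices only.\<close>
  have "\<exists>w \<in> pverts (cuttlefish n). \<forall>c \<in> pverts (cuttlefish n). cf_dist n u c = cf_dist n u w \<longrightarrow> far c"
  proof (cases u)
    case (V i)
    \<comment> \<open>From \<open>V i\<close> the distance \<open>i + m\<close> exceeds its own
      path, meets the cycle only in antipodes of \<open>U 1\<close>, and meets the other path only
      at its end because \<open>U 2\<close> is one step beyond \<open>U 1\<close>.\<close>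
    have "far c" if c: "c \<in> pverts (cuttlefish n)" "cf_dist n u c = i + m" for c
    proof (cases c)
      case (U k)
      with c V show ?thesis using antipode[of 1 k] u' by (simp add: cf_dist_U mem_cuttlefish)
    next
      case (W j)
      with c V m show ?thesis using end_W[of j] by (simp add: cf_dist_def cycle_dist_def)
    next
      case (V j)
      with c \<open>u = V i\<close> u' m show ?thesis by (auto simp: cf_dist_def mem_cuttlefish)
    qed
    moreover have "cf_dist n u (U (m + 1)) = i + m" "U (m + 1) \<in> pverts (cuttlefish n)"
      using V u' m cycle_dist_add[of m n 1] by (auto simp: cf_dist_U mem_cuttlefish)
    ultimately show ?thesis by (intro bexI[of _ "U (m + 1)"]) auto
  next
    case (W i)
    have "far c" if c: "c \<in> pverts (cuttlefish n)" "cf_dist n u c = i + m" for c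
    proof (cases c)
      case (U k)
      with c W show ?thesis using antipode[of 2 k] u' by (simp add: cf_dist_U mem_cuttlefish)
    next
      case (V j)
      with c W m show ?thesis using end_V[of j] by (simp add: cf_dist_def cycle_dist_def)
    next
      case (W j)
      with c \<open>u = W i\<close> u' m show ?thesis by (auto simp: cf_dist_def mem_cuttlefish)
    qed
    moreover have "cf_dist n u (U (m + 2)) = i + m" "U (m + 2) \<in> pverts (cuttlefish n)"
      using W u' m cycle_dist_add[of m n 2] by (auto simp: cf_dist_U mem_cuttlefish)
    ultimately show ?thesis by (intro bexI[of _ "U (m + 2)"]) auto
  next
    case (U i)
    have i: "1 \<le> i" "i \<le> n" using U u' by (auto simp: mem_cuttlefish)
    \<comment> \<open>The distance to the farther path end, so a path vertex at distance
      \<open>d\<close> must be an end. On the cycle, \<open>d\<close> exceeds \<open>m\<close>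
      unless \<open>i\<close> is 1 or 2, and then only antipodes of \<open>U i\<close>
      remain.\<close>
    define d where "d = max (cycle_dist n i 1) (cycle_dist n i 2) + (m - 1)"
    have dV: "cf_dist n u (V j) = cycle_dist n i 1 + j" and dW: "cf_dist n u (W j) = cycle_dist n i 2 + j" for j
      unfolding U by (auto simp: cf_dist_def cycle_dist_def)
    have "far c" if c: "c \<in> pverts (cuttlefish n)" "cf_dist n u c = d" for c
    proof (cases c)
      case [simp]: (U k)
      have d: "cycle_dist n i k = d" using c \<open>u = U i\<close> u' by (simp add: cf_dist_U)
      show ?thesis
      proof (cases "i = 1 \<or> i = 2")
        case True
        then have "d \<ge> m" using m by (auto simp: d_def cycle_dist_def)
        then show ?thesis using antipode[of i k] True c d by (simp add: mem_cuttlefish)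
      next
        case False
        then have "cycle_dist n i 1 \<ge> 2 \<or> cycle_dist n i 2 \<ge> 2"
          using i n unfolding cycle_dist_def by auto
        then have "d > m" by (auto simp: d_def)
        then show ?thesis using d cycle_dist_le[of n i k] by (simp add: m_def)
      qed
    next
      case (V j)
      then show ?thesis using c end_V[of j] by (simp add: dV d_def)
    next
      case (W j)
      then show ?thesis using c end_W[of j] by (simp add: dW d_def)
    qed
    moreover define w where "w = (if cycle_dist n i 2 \<le> cycle_dist n i 1 then V (m - 1) else W (m - 1))"
    moreover have "cf_dist n u w = d" by (simp add: w_def dV dW d_def)
    moreover have "w \<in> pverts (cuttlefish n)" using m by (auto simp: w_def mem_cuttlefish m_def)
    ultimately show ?thesis by (intro bexI[of _ w]) auto
  qed
  then obtain w where "w \<in> pverts (cuttlefish n)"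
    "\<And>c. c \<in> pverts (cuttlefish n) \<Longrightarrow> cf_dist n u c = cf_dist n u w \<Longrightarrow> far c" by blast
  then obtain p q where "p \<in> C" "q \<in> pverts (cuttlefish n)" "2 * m \<le> Suc (cf_dist n p q)"
    using closed_reaches[OF n C u, of w "cf_dist n u w"] unfolding far_def by blast
  then show ?thesis using card_closed_ge(1)[OF n C fin, of p q] unfolding m_def by simp
qed

text \<open>
  In a closed set of size \<open>2 * (n div 2)\<close> the distances from the exceptional vertex would be pairwise
  distinct, but the set contains two of its vertices at the same distance.
\<close>

lemma card_closed_odd_aux:
  assumes n: "n \<ge> 5" "odd n" and C: "closed_set (cuttlefish n) C" "C \<subseteq> pverts (cuttlefish n)"
    and x: "U (n div 2 + 2) \<in> C" and V: "V (n div 2 - 1) \<in> C"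
  shows "2 * (n div 2) + 1 \<le> card C"
proof -
  define m where "m = n div 2"
  have m: "m \<ge> 2" "n = 2 * m + 1" using n by (auto simp: m_def)
  note x = x[folded m_def] and V = V[folded m_def]
  have fin: "finite C" using C(2) finite_cuttlefish finite_subset by blast
  have verts: "U k \<in> pverts (cuttlefish n)" if "1 \<le> k" "k \<le> n" for k
    using that by (simp add: mem_cuttlefish)
  have dV: "cf_dist n (V (m - 1)) (U k) = m - 1 + cycle_dist n 1 k" for k
    by (auto simp: cf_dist_def cycle_dist_def)
  have far: "cf_dist n (V (m - 1)) (U (m + 1)) = 2 * m - 1"
    using m by (simp add: cf_dist_def cycle_dist_def)
  \<comment> \<open>All \<open>V\<close> vertices are nearer to \<open>V (m - 1)\<close> than this,
    and all \<open>W\<close> vertices are farther.\<close>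
  have eV: "c = U 1 \<or> c = U 2 \<or> c = U n"
    if c: "c \<in> pverts (cuttlefish n)" "cf_dist n (V (m - 1)) c = d" "d = m - 1 \<or> d = m" for c d
  proof (cases c)
    case (U k)
    then have "cycle_dist n 1 k \<le> 1" "1 \<le> k" "k \<le> n" using c dV[of k] by (auto simp: mem_cuttlefish)
    then have "k = 1 \<or> k = 2 \<or> k = n" unfolding cycle_dist_def by linarith
    with U show ?thesis by blast
  next
    case (V j)
    with c m show ?thesis by (auto simp: cf_dist_def mem_cuttlefish)
  next
    case (W j)
    with c m show ?thesis by (auto simp: cf_dist_def mem_cuttlefish cycle_dist_def)
  qed
  have d12: "cf_dist n (V (m - 1)) (U 1) = m - 1" "cf_dist n (V (m - 1)) (U 2) = m"
    "cf_dist n (V (m - 1)) (U n) = m"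
    using m by (auto simp: cf_dist_def cycle_dist_def)
  have le: "m - 1 \<le> 2 * m - 1" "m \<le> 2 * m - 1" using m by linarith+
  obtain a where "a \<in> C" "a \<in> pverts (cuttlefish n)" "cf_dist n (V (m - 1)) a = m - 1"
    using closed_reaches[OF n(1) C V verts[of "m + 1"], of "m - 1"] far le m by auto
  then have U1: "U 1 \<in> C" using eV[of a "m - 1"] d12 m by auto
  obtain b where "b \<in> C" "b \<in> pverts (cuttlefish n)" "cf_dist n (V (m - 1)) b = m"
    using closed_reaches[OF n(1) C V verts[of "m + 1"], of m] far le m by auto
  then have b: "U 2 \<in> C \<or> U n \<in> C" using eV[of b m] d12 m by auto
  \<comment> \<open>\<open>U 1\<close> and \<open>U 2\<close> are equally far from
    \<open>U (m + 2)\<close>. If \<open>U 2\<close> is missing, \<open>U n\<close> forces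
    \<open>W (m - 1)\<close> into \<open>C\<close>, and the two path ends collide instead.\<close>
  have "\<exists>a b. a \<in> C \<and> b \<in> C \<and> a \<noteq> b \<and> cf_dist n (U (m + 2)) a = cf_dist n (U (m + 2)) b"
  proof (cases "U 2 \<in> C")
    case True
    have "cf_dist n (U (m + 2)) (U 1) = cf_dist n (U (m + 2)) (U 2)"
      using m by (simp add: cf_dist_def cycle_dist_def)
    with U1 True show ?thesis by (intro exI[of _ "U 1"] exI[of _ "U 2"]) auto
  next
    case False
    then have Un: "U n \<in> C" using b by blast
    have W: "W (m - 1) \<in> pverts (cuttlefish n)" "cf_dist n (U n) (W (m - 1)) = m + 1"
      using m by (auto simp: mem_cuttlefish cf_dist_def cycle_dist_def)
    then obtain c where c: "c \<in> C" "c \<in> pverts (cuttlefish n)" "cf_dist n (U n) c = m + 1"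
      using closed_reaches[OF n(1) C Un W(1), of "m + 1"] by auto
    have "c = W (m - 1)"
    proof (cases c)
      case (U k)
      then have "cycle_dist n n k = m + 1" using c verts[of n] m by (simp add: cf_dist_U)
      with cycle_dist_le[of n n k] show ?thesis by (simp add: m_def)
    next
      case (V j)
      with c m show ?thesis by (auto simp: cf_dist_def mem_cuttlefish cycle_dist_def)
    next
      case (W j)
      with c m show ?thesis by (auto simp: cf_dist_def mem_cuttlefish cycle_dist_def)
    qed
    moreover have "cf_dist n (U (m + 2)) (V (m - 1)) = cf_dist n (U (m + 2)) (W (m - 1))"
      using m by (simp add: cf_dist_def cycle_dist_def)
    ultimately show ?thesis using c V by (intro exI[of _ "V (m - 1)"] exI[of _ "W (m - 1)"]) auto
  qed
  then obtain a b where ab: "a \<in> C" "b \<in> C" "a \<noteq> b" "cf_dist n (U (m + 2)) a = cf_dist n (U (m + 2)) b"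
    by blast
  have "V (m - 1) \<in> pverts (cuttlefish n)" using V C(2) by blast
  from card_closed_ge(2)[OF n(1) C fin x this ab]
  have "Suc (Suc (cf_dist n (U (m + 2)) (V (m - 1)))) \<le> card C" .
  moreover have "cf_dist n (U (m + 2)) (V (m - 1)) = 2 * m - 1"
    using m by (simp add: cf_dist_def cycle_dist_def)
  ultimately show ?thesis using m unfolding m_def by simp
qed

text \<open>Only the two path ends are at distance \<open>2 * (n div 2) - 1\<close> from the
  exceptional vertex, so \<open>C\<close> contains one of them. \<open>mirror\<close> fixes that
  vertex and swaps the ends, so the end may be taken on the \<open>V\<close> path.\<close>

lemma card_closed_odd:
  assumes n: "n \<ge> 5" "odd n" and C: "closed_set (cuttlefish n) C" "C \<subseteq> pverts (cuttlefish n)"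
    and x: "U (n div 2 + 2) \<in> C"
  shows "2 * (n div 2) + 1 \<le> card C"
proof -
  define m where "m = n div 2"
  have m: "m \<ge> 2" "n = 2 * m + 1" using n by (auto simp: m_def)
  have far: "V (m - 1) \<in> pverts (cuttlefish n)" "cf_dist n (U (m + 2)) (V (m - 1)) = 2 * m - 1"
    using m by (auto simp: mem_cuttlefish cf_dist_def cycle_dist_def)
  obtain c where c: "c \<in> C" "c \<in> pverts (cuttlefish n)" "cf_dist n (U (m + 2)) c = 2 * m - 1"
    using closed_reaches[OF n(1) C x far(1)] far(2) unfolding m_def by auto
  have "c = V (m - 1) \<or> c = W (m - 1)"
  proof (cases c)
    case (U k)
    then have "cycle_dist n (m + 2) k = 2 * m - 1" using c m by (simp add: cf_dist_U mem_cuttlefish)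
    with cycle_dist_le[of n "m + 2" k] m show ?thesis by simp
  next
    case (V j)
    with c m show ?thesis by (auto simp: cf_dist_def mem_cuttlefish cycle_dist_def)
  next
    case (W j)
    with c m show ?thesis by (auto simp: cf_dist_def mem_cuttlefish cycle_dist_def)
  qed
  then show ?thesis
  proof
    assume "c = V (m - 1)"
    with c(1) show ?thesis using card_closed_odd_aux[OF n C x] by (simp add: m_def)
  next
    assume "c = W (m - 1)"
    then have "mirror n c = V (m - 1)" by simp
    then have "V (n div 2 - 1) \<in> mirror n ` C" using c(1) unfolding m_def by (metis image_eqI)
    moreover have "mirror n (U (n div 2 + 2)) = U (n div 2 + 2)" using m by simp
    then have "U (n div 2 + 2) \<in> mirror n ` C" using x by (metis image_eqI)
    moreover have "mirror n ` C \<subseteq> pverts (cuttlefish n)" using C(2) mirror_mem[of n] n(1) by force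
    ultimately have "2 * (n div 2) + 1 \<le> card (mirror n ` C)"
      using card_closed_odd_aux[OF n closed_set_mirror[OF n(1) C]] by blast
    then show ?thesis using card_image inj_on_subset[OF inj_on_mirror C(2)] by metis
  qed
qed

section \<open>Closed sets attaining the bounds\<close>

text \<open>The vertices of a shortest path from the end of the \<open>V\<close> path through
  \<open>U 1\<close> to an antipode of \<open>U 1\<close>.\<close>

definition cf_half :: "nat \<Rightarrow> cf_vertex set" where
  "cf_half n = V ` {1..n div 2 - 1} \<union> U ` {1..n div 2 + 1}"

lemma cf_half_subset: "n \<ge> 5 \<Longrightarrow> cf_half n \<subseteq> pverts (cuttlefish n)"
  by (auto simp: cf_half_def mem_cuttlefish)

lemma card_cf_half:
  assumes "n \<ge> 5"
  shows "card (cf_half n) = 2 * (n div 2)"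
proof -
  have "card (cf_half n) = card (V ` {1..n div 2 - 1}) + card (U ` {1..n div 2 + 1})"
    unfolding cf_half_def by (rule card_Un_disjoint) auto
  also have "\<dots> = 2 * (n div 2)" using assms by (simp add: card_image inj_on_def)
  finally show ?thesis .
qed

text \<open>Being a geodesic, \<open>cf_half n\<close> realises from \<open>u\<close> every distance
  up to that of its farther end; the bounds on \<open>d\<close> show that no vertex of the graph is
  farther away.\<close>

lemma cf_half_reaches:
  assumes n: "n \<ge> 5" and u: "u \<in> cf_half n" and w: "w \<in> pverts (cuttlefish n)"
  shows "\<exists>c \<in> cf_half n. cf_dist n u c = cf_dist n u w"
proof -
  define m where "m = n div 2"
  have m: "m \<ge> 2" "n = 2 * m \<or> n = 2 * m + 1" using n by (auto simp: m_def)
  have memV: "V j \<in> cf_half n \<longleftrightarrow> 1 \<le> j \<and> j \<le> m - 1"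
    and memU: "U j \<in> cf_half n \<longleftrightarrow> 1 \<le> j \<and> j \<le> m + 1" for j
    by (auto simp: cf_half_def m_def)
  have u': "u \<in> pverts (cuttlefish n)" using u cf_half_subset[OF n] by blast
  define d where "d = cf_dist n u w"
  show ?thesis
  proof (cases u)
    case (V i)
    then have i: "1 \<le> i" "i \<le> m - 1" using u memV by auto
    have "d \<le> i + m"
    proof (cases w)
      case (U k)
      with V u' cycle_dist_le[of n 1 k] show ?thesis by (simp add: d_def cf_dist_U m_def)
    next
      case (V j)
      with \<open>u = V i\<close> w show ?thesis by (auto simp: d_def cf_dist_def mem_cuttlefish m_def)
    next
      case (W j)
      with V w m show ?thesis by (auto simp: d_def cf_dist_def mem_cuttlefish cycle_dist_def)
    qed
    show ?thesis
    proof (cases "d < i")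
      case True
      then show ?thesis unfolding d_def[symmetric] using V i
        by (intro bexI[of _ "V (i - d)"]) (auto simp: memV cf_dist_def)
    next
      case False
      then have "cf_dist n u (U (1 + (d - i))) = d"
        using V u' \<open>d \<le> i + m\<close> cycle_dist_add[of "d - i" n 1] by (simp add: cf_dist_U m_def)
      moreover have "U (1 + (d - i)) \<in> cf_half n" using \<open>d \<le> i + m\<close> by (simp add: memU)
      ultimately show ?thesis unfolding d_def by blast
    qed
  next
    case (U i)
    then have i: "1 \<le> i" "i \<le> m + 1" using u memU by auto
    have i1: "cycle_dist n i 1 = i - 1"
      using i m unfolding cycle_dist_def by auto
    \<comment> \<open>For \<open>i = 1\<close> the farther end is \<open>U (m + 1)\<close>, at
      distance \<open>m\<close>; for larger \<open>i\<close> it is \<open>V (m - 1)\<close>.\<close>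
    have d: "d \<le> max (i - 1 + (m - 1)) m"
    proof (cases w)
      case (U k)
      with \<open>u = U i\<close> u' cycle_dist_le[of n i k] show ?thesis by (simp add: d_def cf_dist_U m_def)
    next
      case (V j)
      with \<open>u = U i\<close> w i i1 show ?thesis by (auto simp: d_def cf_dist_def mem_cuttlefish m_def)
    next
      case (W j)
      then have "d = cycle_dist n i 2 + j" "j \<le> m - 1"
        using \<open>u = U i\<close> w by (auto simp: d_def cf_dist_def mem_cuttlefish m_def cycle_dist_def)
      moreover have "cycle_dist n i 2 \<le> (if i = 1 then 1 else i - 1)"
        using i m unfolding cycle_dist_def by auto
      ultimately show ?thesis using m by (auto split: if_splits)
    qed
    consider "d < i" | "i \<le> d" "2 \<le> i" | "i \<le> d" "i = 1" using i by linarith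
    then show ?thesis
    proof cases
      case 1
      then have "cf_dist n u (U (i - d)) = d"
        using U u' i cycle_dist_add[of d n "i - d"] cycle_dist_commute[of n i]
        by (simp add: cf_dist_U m_def)
      moreover have "U (i - d) \<in> cf_half n" using 1 i by (auto simp: memU)
      ultimately show ?thesis unfolding d_def by blast
    next
      case 2
      then have "cf_dist n u (V (d - (i - 1))) = d" using U i1 by (auto simp: cf_dist_def)
      moreover have "V (d - (i - 1)) \<in> cf_half n" using 2 d m by (auto simp: memV)
      ultimately show ?thesis unfolding d_def by blast
    next
      case 3
      then have "cf_dist n u (U (1 + d)) = d"
        using U u' d cycle_dist_add[of d n 1] by (simp add: cf_dist_U m_def)
      moreover have "U (1 + d) \<in> cf_half n" using 3 d by (simp add: memU)
      ultimately show ?thesis unfolding d_def by blast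
    qed
  qed (use u in \<open>auto simp: cf_half_def\<close>)
qed

lemma closed_cf_half:
  assumes "n \<ge> 5"
  shows "closed_set (cuttlefish n) (cf_half n)"
  using closed_set_cuttlefish_iff[OF assms cf_half_subset[OF assms]] cf_half_reaches[OF assms]
  by simp

text \<open>Adding a vertex cannot spoil the condition at the old ones, so only distances from the
  new vertex remain to be checked.\<close>

lemma closed_cf_half_insert:
  assumes n: "n \<ge> 5" "odd n"
  shows "closed_set (cuttlefish n) (insert (U (n div 2 + 2)) (cf_half n))"
proof -
  define m where "m = n div 2"
  have m: "m \<ge> 2" "n = 2 * m + 1" using n by (auto simp: m_def)
  let ?x = "U (m + 2)"
  have x: "?x \<in> pverts (cuttlefish n)" using m by (simp add: mem_cuttlefish)
  have "\<exists>c \<in> insert ?x (cf_half n). cf_dist n ?x c = cf_dist n ?x w"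
    if w: "w \<in> pverts (cuttlefish n)" for w
  proof -
    define d where "d = cf_dist n ?x w"
    have m12: "cycle_dist n (m + 2) 1 = m" "cycle_dist n (m + 2) 2 = m"
      using m by (auto simp: cycle_dist_def)
    have d: "d \<le> 2 * m - 1"
    proof (cases w)
      case (U k)
      with x cycle_dist_le[of n "m + 2" k] m show ?thesis by (simp add: d_def cf_dist_U)
    next
      case (V j)
      with w m m12 show ?thesis by (auto simp: d_def cf_dist_def mem_cuttlefish)
    next
      case (W j)
      with w m m12 show ?thesis by (auto simp: d_def cf_dist_def mem_cuttlefish)
    qed
    show ?thesis
    \<comment> \<open>Distances up to \<open>m\<close> occur on the way down to \<open>U 2\<close>;
      larger ones occur on the \<open>V\<close> path, since \<open>U 1\<close> is at distance
      \<open>m\<close> along the other arc.\<close>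
    proof (cases "d \<le> m")
      case True
      then have "cf_dist n ?x (U (m + 2 - d)) = d"
        using x m cycle_dist_add[of d n "m + 2 - d"] cycle_dist_commute[of n "m + 2"]
        by (simp add: cf_dist_U)
      moreover have "U (m + 2 - d) \<in> insert ?x (cf_half n)"
        using True by (cases "d = 0") (auto simp: cf_half_def m_def[symmetric] image_iff)
      ultimately show ?thesis unfolding d_def by blast
    next
      case False
      then have "cf_dist n ?x (V (d - m)) = d" using m12 by (simp add: cf_dist_def)
      moreover have "V (d - m) \<in> cf_half n"
        using False d by (auto simp: cf_half_def m_def[symmetric] image_iff)
      ultimately show ?thesis unfolding d_def by blast
    qed
  qed
  moreover have "\<exists>c \<in> insert ?x (cf_half n). cf_dist n u c = cf_dist n u w"
    if "u \<in> cf_half n" "w \<in> pverts (cuttlefish n)" for u w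
    using cf_half_reaches[OF n(1) that] by simp
  moreover have "insert ?x (cf_half n) \<subseteq> pverts (cuttlefish n)"
    using x cf_half_subset[OF n(1)] by simp
  ultimately have "closed_set (cuttlefish n) (insert ?x (cf_half n))"
    using closed_set_cuttlefish_iff[OF n(1)] by simp
  then show ?thesis by (simp only: m_def)
qed

text \<open>Reflection sends the \<open>W\<close> path to the \<open>V\<close> path, and it sends
  \<open>U k\<close> beyond the half to \<open>U (n + 3 - k)\<close>, which lies in the half unless
  \<open>n\<close> is odd and \<open>k = n div 2 + 2\<close>.\<close>

lemma cuttlefish_cover:
  assumes n: "n \<ge> 5" and v: "v \<in> pverts (cuttlefish n)" "odd n \<longrightarrow> v \<noteq> U (n div 2 + 2)"
  shows "v \<in> cf_half n \<union> mirror n ` cf_half n"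
proof (cases "v \<in> cf_half n")
  case False
  have "mirror n v \<in> cf_half n"
  proof (cases v)
    case (U k)
    have k: "n div 2 + 1 < k" "k \<le> n" using False U v(1) by (auto simp: cf_half_def mem_cuttlefish)
    then have "n + 3 - k \<le> n div 2 + 1" using U v(2) by (cases "even n") (auto elim!: evenE oddE)
    then show ?thesis using U k n by (auto simp: cf_half_def)
  qed (use v(1) False in \<open>auto simp: cf_half_def mem_cuttlefish\<close>)
  then show ?thesis using mirror_mirror[OF v(1)] by (metis UnI2 image_eqI)
qed simp

section \<open>The value of the game\<close>

text \<open>Combines \<open>director_bound\<close> and \<open>explorer_bound\<close>. In
  \<open>lower\<close>, \<open>S\<close> is the visited set and \<open>B\<close> the closed set in
  which the Director settles; \<open>v\<close> belongs to \<open>S\<close> but possibly not to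
  \<open>B\<close>.\<close>

lemma is_game_value_cuttlefish:
  assumes n: "n \<ge> 5" and v: "v \<in> pverts (cuttlefish n)"
    and C: "closed_set (cuttlefish n) C" "C \<subseteq> pverts (cuttlefish n)" "v \<in> C"
    and lower: "\<And>S B. S \<subseteq> pverts (cuttlefish n) \<Longrightarrow> v \<in> S \<Longrightarrow> B \<subseteq> S \<Longrightarrow> B \<noteq> {} \<Longrightarrow>
      closed_set (cuttlefish n) B \<Longrightarrow> card C \<le> card S"
  shows "is_game_value (cuttlefish n) v (card C)"
  unfolding is_game_value_def
proof
  show "\<exists>\<epsilon> \<in> explorer_strategies (cuttlefish n). \<forall>\<delta> \<in> director_strategies (cuttlefish n).
      card C \<le> card (visited (cuttlefish n) \<epsilon> \<delta> v)"
  proof (rule explorer_bound)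
    fix u assume "u \<in> verts (with_proj (cuttlefish n))"
    then have u: "u \<in> pverts (cuttlefish n)" by simp
    then show "\<exists>d. at_distance (cuttlefish n) u d \<noteq> {}"
      using at_distance_cuttlefish[OF n u] by blast
  next
    fix S u assume S: "S \<subseteq> verts (with_proj (cuttlefish n))" "v \<in> S" "can_stay (cuttlefish n) S u"
    from S(3) obtain B where "closed_set (cuttlefish n) B" "B \<subseteq> S" "u \<in> B"
      by (rule can_stay_imp_closed_set)
    with S lower[of S B] show "card C \<le> card S" by auto
  qed (use v finite_cuttlefish in simp_all)
  show "\<exists>\<delta> \<in> director_strategies (cuttlefish n). \<forall>\<epsilon> \<in> explorer_strategies (cuttlefish n).
      card (visited (cuttlefish n) \<epsilon> \<delta> v) \<le> card C"
    using C finite_subset[OF C(2) finite_cuttlefish] by (intro director_bound) auto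
qed

theorem theorem5p2:
  fixes n :: nat
  assumes "n \<ge> 5"
  shows "(even n \<longrightarrow> (\<forall>v \<in> pverts (cuttlefish n). f_d (cuttlefish n) v = 2 * (n div 2))) \<and>
         (odd n \<longrightarrow>
            (\<forall>v \<in> pverts (cuttlefish n) - {U ((n + 3) div 2)}.
               f_d (cuttlefish n) v = 2 * (n div 2)) \<and>
            f_d (cuttlefish n) (U ((n + 3) div 2)) = 2 * (n div 2) + 1)"
proof -
  note n = assms
  have card_ge: "2 * (n div 2) \<le> card S"
    if "S \<subseteq> pverts (cuttlefish n)" "B \<subseteq> S" "B \<noteq> {}" "closed_set (cuttlefish n) B" for S B
  proof -
    have "finite S" using that(1) finite_cuttlefish finite_subset by blast
    then have "card B \<le> card S" using that(2) card_mono by blast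
    moreover have "2 * (n div 2) \<le> card B"
      using card_closed[OF n that(4) _ that(3)] that(1,2) by blast
    ultimately show ?thesis by simp
  qed
  have generic: "f_d (cuttlefish n) v = 2 * (n div 2)"
    if v: "v \<in> pverts (cuttlefish n)" "odd n \<longrightarrow> v \<noteq> U (n div 2 + 2)" for v
  proof -
    have "\<exists>C. closed_set (cuttlefish n) C \<and> C \<subseteq> pverts (cuttlefish n) \<and> v \<in> C \<and>
      card C = 2 * (n div 2)"
    proof (cases "v \<in> cf_half n")
      case True
      then show ?thesis using closed_cf_half[OF n] cf_half_subset[OF n] card_cf_half[OF n] by blast
    next
      case False
      then have "v \<in> mirror n ` cf_half n" using cuttlefish_cover[OF n v] by blast
      moreover have "card (mirror n ` cf_half n) = 2 * (n div 2)"
        using card_image[OF inj_on_subset[OF inj_on_mirror cf_half_subset[OF n]]]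
          card_cf_half[OF n] by simp
      moreover have "mirror n ` cf_half n \<subseteq> pverts (cuttlefish n)"
        using cf_half_subset[OF n] mirror_mem[of n] n by force
      ultimately show ?thesis
        using closed_set_mirror[OF n closed_cf_half[OF n] cf_half_subset[OF n]] by blast
    qed
    then obtain C where C: "closed_set (cuttlefish n) C" "C \<subseteq> pverts (cuttlefish n)" "v \<in> C"
      and card_C: "card C = 2 * (n div 2)" by blast
    have "is_game_value (cuttlefish n) v (card C)"
      by (rule is_game_value_cuttlefish[OF n v(1) C]) (unfold card_C, rule card_ge, assumption+)
    then show ?thesis unfolding card_C by (rule f_d_eqI)
  qed
  have special: "f_d (cuttlefish n) (U (n div 2 + 2)) = 2 * (n div 2) + 1" if odd: "odd n"
  proof -
    let ?x = "U (n div 2 + 2)"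
    let ?C = "insert ?x (cf_half n)"
    have x: "?x \<in> pverts (cuttlefish n)" using n odd by (auto simp: mem_cuttlefish elim!: oddE)
    have "finite (cf_half n)" "?x \<notin> cf_half n" by (auto simp: cf_half_def)
    then have card_C: "card ?C = 2 * (n div 2) + 1" using card_cf_half[OF n] by simp
    have "card ?C \<le> card S"
      if S: "S \<subseteq> pverts (cuttlefish n)" "?x \<in> S" "B \<subseteq> S" "B \<noteq> {}" "closed_set (cuttlefish n) B" for S B
    proof -
      have fin: "finite S" using S(1) finite_cuttlefish finite_subset by blast
      have B: "B \<subseteq> pverts (cuttlefish n)" using S(1,3) by blast
      show ?thesis
      proof (cases "?x \<in> B")
        case True
        have "card B \<le> card S" using fin S(3) by (rule card_mono)
        with card_closed_odd[OF n odd S(5) B True] card_C show ?thesis by simp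
      next
        case False
        \<comment> \<open>The start is visited but lies outside \<open>B\<close>, which adds one to
          the bound \<open>2 * (n div 2)\<close> for \<open>B\<close>.\<close>
        then have "B \<subset> S" using S(2,3) by blast
        then have "card B < card S" using fin by (rule psubset_card_mono[rotated])
        with card_closed[OF n S(5) B S(4)] card_C show ?thesis by simp
      qed
    qed
    then have "is_game_value (cuttlefish n) ?x (card ?C)"
      using x cf_half_subset[OF n]
      by (intro is_game_value_cuttlefish[OF n x closed_cf_half_insert[OF n odd]]) auto
    then show ?thesis unfolding card_C by (rule f_d_eqI)
  qed
  have "(n + 3) div 2 = n div 2 + 2" if "odd n" using that by (auto elim!: oddE)
  then show ?thesis using generic special by auto
qed

end
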